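(* Let $n,d,h\ge1$ and $i_1,\dots,i_h,j_1,\dots,j_h\in\{1,\dots,n\}$. The action of the column Capelli bitableau $$\left[\begin{array}{c}i_1\\ i_2\\ \vdots\\ i_h\end{array}\right|\left.\begin{array}{c}j_1\\ j_2\\ \vdots\\ j_h\end{array}\right]\in\mathbf U(gl(n))$$ on the algebra $\mathbb C[M_{n,d}]$ equals the action of the polynomial differential operator $$(-1)^{\binom h2}\sum_{(\varphi_1,\dots,\varphi_h)\in\{1,\dots,d\}^h}(i_1|\varphi_1)(i_2|\varphi_2)\cdots(i_h|\varphi_h)\;\partial_{(j_1|\varphi_1)}\partial_{(j_2|\varphi_2)}\cdots\partial_{(j_h|\varphi_h)}.$$
   Context: $\mathbb C[M_{n,d}]$ is the polynomial algebra in commuting variables $(i|\varphi)$, $1\le i\le n$, $1\le\varphi\le d$; $\partial_{(i|\varphi)}$ is the partial derivative with respect to $(i|\varphi)$. $\mathbf U(gl(n))$ acts on $\mathbb C[M_{n,d}]$ by letting $e_{ij}$ act as the derivation $D_{i,j}$ with $D_{i,j}((k|\varphi))=\delta_{jk}(i|\varphi)$. **Virtual variables.** Let $A_0=\{\alpha_1,\dots,\alpha_{m_0}\}$, $A_1=\{\beta_1,\dots,\beta_{m_1}\}$, $L=\{1,\dots,n\}$ be disjoint sets of symbols ($m_0,m_1$ sufficiently large), with parities $|\alpha_s|=0$, $|\beta_t|=|i|=1$ in $\mathbb Z_2$. $gl(m_0|m_1+n)$ is the complex Lie superalgebra with basis $e_{a,b}$, $a,b\in A_0\cup A_1\cup L$,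 $|e_{a,b}|=|a|+|b|$, and superbracket $[e_{a,b},e_{c,d}]=\delta_{bc}e_{a,d}-(-1)^{(|a|+|b|)(|c|+|d|)}\delta_{ad}e_{c,b}$; $gl(n)$ is its Lie subalgebra spanned by $e_{ij}=e_{i,j}$, $i,j\in L$. A product $e_{a_m,b_m}\cdots e_{a_1,b_1}$ in $\mathbf U(gl(m_0|m_1+n))$ is irregular if there are $i\le m$ and $\gamma\in A_0\cup A_1$ with $\#\{j\le i: b_j=\gamma\}>\#\{j<i: a_j=\gamma\}$. $\mathbf{Irr}$ is the left ideal generated by irregular products. It is known that $\mathbf U(gl(n))\cap\mathbf{Irr}=0$ and that $Virt(m_0+m_1,n)=\mathbf U(gl(n))\oplus\mathbf{Irr}$ is a subalgebra in which $\mathbf{Irr}$ is a two-sided ideal; $\mathfrak p:Virt(m_0+m_1,n)\to\mathbf U(gl(n))$ is the projection with kernel $\mathbf{Irr}$. **Column Capelli bitableaux.** For $i_1,\dots,i_h,j_1,\dots,j_h\in\{1,\dots,n\}$ and distinct $\alpha_1,\dots,\alpha_h\in A_0$, $$\left[\begin{array}{c}i_1\\ \vdots\\ i_h\end{array}\right|\left.\begin{array}{c}j_1\\ \vdots\\ j_h\end{array}\right]=\mathfrak p\big(e_{i_1,\alpha_1}\cdots e_{i_h,\alpha_h}\,e_{\alpha_1,j_1}\cdots e_{\alpha_h,j_h}\big)\in\mathbf U(gl(n))$$ (the argument of $\mathfrak p$ lies in $Virt(m_0+m_1,n)$, and the result does not depend on the choice of the $\alpha$'s). *)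

theory Defs
  imports Complex_Main "HOL-Library.Poly_Mapping"
begin

section \<open>Free associative algebras\<close>

text \<open>
  Words form a monoid under concatenation, so that the convolution product makes
  \<open>'g list \<Rightarrow>\<^sub>0 complex\<close> the free associative unital algebra over the complex numbers
  on the set of generators \<open>'g\<close>.
\<close>

instantiation list :: (type) monoid_add
begin

definition zero_list :: "'a list" where "zero_list = []"

definition plus_list :: "'a list \<Rightarrow> 'a list \<Rightarrow> 'a list" where "plus_list = (@)"

instance
  by standard (simp_all add: zero_list_def plus_list_def)

end

type_synonym 'g free_alg = "'g list \<Rightarrow>\<^sub>0 complex"

definition fgen :: "'g \<Rightarrow> 'g free_alg" where
  "fgen g = Poly_Mapping.single [g] 1"

inductive_set left_ideal :: "'r::ring_1 set \<Rightarrow> 'r set" for S where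
  zero: "0 \<in> left_ideal S"
| gen: "s \<in> S \<Longrightarrow> r * s \<in> left_ideal S"
| add: "x \<in> left_ideal S \<Longrightarrow> y \<in> left_ideal S \<Longrightarrow> x + y \<in> left_ideal S"

inductive_set two_sided_ideal :: "'r::ring_1 set \<Rightarrow> 'r set" for S where
  zero: "0 \<in> two_sided_ideal S"
| gen: "s \<in> S \<Longrightarrow> r * s * t \<in> two_sided_ideal S"
| add: "x \<in> two_sided_ideal S \<Longrightarrow> y \<in> two_sided_ideal S \<Longrightarrow> x + y \<in> two_sided_ideal S"

lemma two_sided_ideal_mult:
  assumes "x \<in> two_sided_ideal S"
  shows "a * x * b \<in> two_sided_ideal S"
  using assms
proof induction
  case zero
  show ?case by (simp add: two_sided_ideal.zero)
next
  case (gen s r t)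
  show ?case
    using two_sided_ideal.gen[OF gen, of "a * r" "t * b"] by (simp add: mult.assoc)
next
  case (add x y)
  then show ?case
    by (simp add: distrib_left distrib_right two_sided_ideal.add)
qed

lemma two_sided_ideal_uminus: "x \<in> two_sided_ideal S \<Longrightarrow> - x \<in> two_sided_ideal S"
  using two_sided_ideal_mult[of x S "-1" 1] by simp

lemma two_sided_ideal_least:
  assumes "x \<in> two_sided_ideal S"
    and "P 0" and "\<And>r s t. s \<in> S \<Longrightarrow> P (r * s * t)"
    and "\<And>x y. P x \<Longrightarrow> P y \<Longrightarrow> P (x + y)"
  shows "P x"
  using assms(1) by induction (use assms in auto)

lemma poly_mapping_add_induct [case_names zero single add]:
  assumes zero: "P 0"
    and single: "\<And>k c. P (Poly_Mapping.single k c)"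
    and add: "\<And>p q. P p \<Longrightarrow> P q \<Longrightarrow> P (p + q)"
  shows "P (p :: 'a \<Rightarrow>\<^sub>0 'b::comm_monoid_add)"
proof -
  have "P (\<Sum>k\<in>A. Poly_Mapping.single k (Poly_Mapping.lookup p k))" if "finite A" for A
    using that by induction (auto intro: assms)
  moreover have "(\<Sum>k\<in>Poly_Mapping.keys p. Poly_Mapping.single k (Poly_Mapping.lookup p k)) = p"
    by (rule poly_mapping_eqI)
      (auto simp: lookup_sum lookup_single when_def in_keys_iff sum.delta)
  ultimately show ?thesis
    by (metis finite_keys)
qed

text \<open>Additive extension of a map given on the terms \<open>c \<cdot> k\<close>.\<close>

lemma sum_keys_add:
  fixes F :: "'a \<Rightarrow> 'b::comm_monoid_add \<Rightarrow> 'c::comm_monoid_add"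
  assumes "\<And>k. F k 0 = 0" and "\<And>k c d. F k (c + d) = F k c + F k d"
  shows "(\<Sum>k\<in>Poly_Mapping.keys (p + q). F k (Poly_Mapping.lookup (p + q) k))
    = (\<Sum>k\<in>Poly_Mapping.keys p. F k (Poly_Mapping.lookup p k)) + (\<Sum>k\<in>Poly_Mapping.keys q. F k (Poly_Mapping.lookup q k))"
proof -
  let ?A = "Poly_Mapping.keys p \<union> Poly_Mapping.keys q"
  have *: "(\<Sum>k\<in>Poly_Mapping.keys r. F k (Poly_Mapping.lookup r k)) = (\<Sum>k\<in>?A. F k (Poly_Mapping.lookup r k))"
    if "Poly_Mapping.keys r \<subseteq> ?A" for r
    by (rule sum.mono_neutral_left) (use that in \<open>auto simp: in_keys_iff assms\<close>)
  have "Poly_Mapping.keys (p + q) \<subseteq> ?A"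
    by (rule keys_add)
  from *[OF this] *[of p] *[of q] show ?thesis
    by (simp only: lookup_add assms sum.distrib Un_upper1 Un_upper2)
qed

section \<open>The enveloping algebra of a general linear Lie superalgebra\<close>

text \<open>A type of symbols with a parity; only the value of the parity modulo 2 matters.\<close>

class graded =
  fixes parity :: "'a \<Rightarrow> nat"

text \<open>The generator \<open>(a, b)\<close> stands for the elementary matrix \<open>e\<^bsub>a,b\<^esub>\<close>.\<close>

definition super_sign :: "'s::graded \<times> 's \<Rightarrow> 's \<times> 's \<Rightarrow> complex" where
  "super_sign = (\<lambda>(a, b) (c, d). (- 1) ^ ((parity a + parity b) * (parity c + parity d)))"

definition superbracket :: "'s::graded \<times> 's \<Rightarrow> 's \<times> 's \<Rightarrow> ('s \<times> 's) free_alg" where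
  "superbracket = (\<lambda>(a, b) (c, d).
     (if b = c then fgen (a, d) else 0)
     - (if a = d then Poly_Mapping.single 0 (super_sign (a, b) (c, d)) * fgen (c, b) else 0))"

definition gl_relator :: "'s::graded \<times> 's \<Rightarrow> 's \<times> 's \<Rightarrow> ('s \<times> 's) free_alg" where
  "gl_relator x y =
     fgen x * fgen y - Poly_Mapping.single 0 (super_sign x y) * (fgen y * fgen x) - superbracket x y"

definition gl_ideal :: "('s::graded \<times> 's) free_alg set" where
  "gl_ideal = two_sided_ideal {gl_relator x y | x y. True}"

definition gl_eq :: "('s::graded \<times> 's) free_alg \<Rightarrow> ('s \<times> 's) free_alg \<Rightarrow> bool" where
  "gl_eq p q \<longleftrightarrow> p - q \<in> gl_ideal"

lemma gl_eq_equivp: "equivp (gl_eq :: ('s::graded \<times> 's) free_alg \<Rightarrow> _)"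
proof (rule equivpI)
  show "reflp (gl_eq :: ('s \<times> 's) free_alg \<Rightarrow> _)"
    by (auto simp: reflp_def gl_eq_def gl_ideal_def intro: two_sided_ideal.zero)
  show "symp (gl_eq :: ('s \<times> 's) free_alg \<Rightarrow> _)"
    unfolding symp_def gl_eq_def gl_ideal_def
    by (auto dest: two_sided_ideal_uminus)
  show "transp (gl_eq :: ('s \<times> 's) free_alg \<Rightarrow> _)"
    unfolding transp_def gl_eq_def gl_ideal_def
    by (auto dest: two_sided_ideal.add)
qed

lemma gl_eq_refl: "gl_eq p p"
  by (rule equivp_reflp[OF gl_eq_equivp])

text \<open>
  \<open>'s Ugl\<close> is \<open>U(gl(V))\<close>, where \<open>V\<close> is the superspace with homogeneous basis \<open>'s\<close>.
\<close>

quotient_type (overloaded) 's Ugl = "('s::graded \<times> 's) free_alg" / gl_eq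
  by (rule gl_eq_equivp)

instantiation Ugl :: (graded) ring_1
begin

lift_definition zero_Ugl :: "'a Ugl" is 0 .
lift_definition one_Ugl :: "'a Ugl" is 1 .

lift_definition plus_Ugl :: "'a Ugl \<Rightarrow> 'a Ugl \<Rightarrow> 'a Ugl" is "(+)"
  unfolding gl_eq_def gl_ideal_def add_diff_add by (rule two_sided_ideal.add)

lift_definition uminus_Ugl :: "'a Ugl \<Rightarrow> 'a Ugl" is uminus
  unfolding gl_eq_def gl_ideal_def minus_diff_minus by (rule two_sided_ideal_uminus)

lift_definition minus_Ugl :: "'a Ugl \<Rightarrow> 'a Ugl \<Rightarrow> 'a Ugl" is "(-)"
proof -
  fix p q r s :: "('a \<times> 'a) free_alg"
  assume "gl_eq p q" "gl_eq r s"
  then have "(p - q) + - (r - s) \<in> gl_ideal"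
    unfolding gl_eq_def gl_ideal_def
    by (intro two_sided_ideal.add two_sided_ideal_uminus)
  then show "gl_eq (p - r) (q - s)"
    by (simp add: gl_eq_def algebra_simps)
qed

lift_definition times_Ugl :: "'a Ugl \<Rightarrow> 'a Ugl \<Rightarrow> 'a Ugl" is "(*)"
proof -
  fix p q r s :: "('a \<times> 'a) free_alg"
  assume "gl_eq p q" "gl_eq r s"
  then have "1 * (p - q) * r + q * (r - s) * 1 \<in> gl_ideal"
    unfolding gl_eq_def gl_ideal_def
    by (intro two_sided_ideal.add two_sided_ideal_mult)
  then show "gl_eq (p * r) (q * s)"
    by (simp add: gl_eq_def algebra_simps)
qed

instance
proof
  show "(0::'a Ugl) \<noteq> 1"
  proof transfer
    have "[] \<notin> Poly_Mapping.keys p" if "p \<in> gl_ideal" for p :: "('a \<times> 'a) free_alg"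
      using that unfolding gl_ideal_def
    proof (rule two_sided_ideal_least)
      fix r s t :: "('a \<times> 'a) free_alg"
      assume "s \<in> {gl_relator x y |x y. True}"
      then have "[] \<notin> Poly_Mapping.keys s"
        by (auto simp: gl_relator_def superbracket_def fgen_def mult_single in_keys_iff
            lookup_minus lookup_single lookup_add plus_list_def zero_list_def split: prod.splits if_splits)
      then show "[] \<notin> Poly_Mapping.keys (r * s * t)"
        using keys_mult[of "r * s" t] keys_mult[of r s] by (auto simp: plus_list_def)
    next
      fix x y :: "('a \<times> 'a) free_alg"
      assume "[] \<notin> Poly_Mapping.keys x" "[] \<notin> Poly_Mapping.keys y"
      then show "[] \<notin> Poly_Mapping.keys (x + y)"
        using keys_add[of x y] by auto
    qed simp
    from this[of "- 1"] show "\<not> gl_eq (0::('a \<times> 'a) free_alg) 1"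
      by (auto simp: gl_eq_def in_keys_iff lookup_one zero_list_def)
  qed
  fix a b c :: "'a Ugl"
  show "a * b * c = a * (b * c)" by transfer (simp add: mult.assoc gl_eq_refl)
  show "1 * a = a" by transfer (simp add: gl_eq_refl)
  show "a * 1 = a" by transfer (simp add: gl_eq_refl)
  show "a + b + c = a + (b + c)" by transfer (simp add: add.assoc gl_eq_refl)
  show "a + b = b + a" by transfer (simp add: add.commute gl_eq_refl)
  show "0 + a = a" by transfer (simp add: gl_eq_refl)
  show "- a + a = 0" by transfer (simp add: gl_eq_refl)
  show "a - b = a + - b" by transfer (simp add: gl_eq_refl)
  show "(a + b) * c = a * c + b * c" by transfer (simp add: distrib_right gl_eq_refl)
  show "a * (b + c) = a * b + a * c" by transfer (simp add: distrib_left gl_eq_refl)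
qed

end

lift_definition Ue :: "'s::graded \<Rightarrow> 's \<Rightarrow> 's Ugl" is "\<lambda>a b. fgen (a, b)" .

lift_definition Uscalar :: "complex \<Rightarrow> 's::graded Ugl" is "Poly_Mapping.single 0" .

lemma Ue_superbracket:
  "Ue a b * Ue c d - Uscalar (super_sign (a, b) (c, d)) * (Ue c d * Ue a b)
   = (if b = c then Ue a d else 0)
     - (if a = d then Uscalar (super_sign (a, b) (c, d)) * Ue c b else 0)"
proof -
  have "gl_eq (fgen (a, b) * fgen (c, d)
      - Poly_Mapping.single 0 (super_sign (a, b) (c, d)) * (fgen (c, d) * fgen (a, b)))
    (superbracket (a, b) (c, d))"
    using two_sided_ideal.gen[of "gl_relator (a, b) (c, d)" "{gl_relator x y |x y. True}" 1 1]
    by (auto simp: gl_eq_def gl_ideal_def gl_relator_def)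
  then have "abs_Ugl (fgen (a, b) * fgen (c, d)
      - Poly_Mapping.single 0 (super_sign (a, b) (c, d)) * (fgen (c, d) * fgen (a, b)))
    = abs_Ugl (superbracket (a, b) (c, d))"
    by (simp only: Ugl.abs_eq_iff)
  then show ?thesis
    by (simp add: superbracket_def Ue.abs_eq Uscalar.abs_eq times_Ugl.abs_eq minus_Ugl.abs_eq
        zero_Ugl.abs_eq)
qed


section \<open>The algebras \<open>U(gl(n))\<close> and \<open>U(gl(m\<^sub>0|m\<^sub>1+n))\<close>\<close>

text \<open>
  The index sets \<open>{1..n}\<close>, \<open>{1..m\<^sub>0}\<close>, \<open>{1..m\<^sub>1}\<close> are finite types \<open>'n\<close>, \<open>'p\<close>, \<open>'q\<close>.
  All proper symbols are odd, so every \<open>e\<^sub>i\<^sub>j\<close> is even, and \<open>'n proper Ugl\<close> is the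
  ordinary enveloping algebra of \<open>gl(n)\<close>.
\<close>

datatype 'n proper = Proper 'n

instantiation proper :: (type) graded
begin
definition parity_proper :: "'a proper \<Rightarrow> nat" where "parity_proper x = 1"
instance ..
end

type_synonym 'n Ugln = "'n proper Ugl"

datatype ('p, 'q, 'n) sym = Alpha 'p | Beta 'q | Low "'n proper"

instantiation sym :: (type, type, type) graded
begin
definition parity_sym :: "('a, 'b, 'c) sym \<Rightarrow> nat" where
  "parity_sym x = (case x of Alpha _ \<Rightarrow> 0 | Beta _ \<Rightarrow> 1 | Low l \<Rightarrow> parity l)"
instance ..
end

definition A0 :: "('p, 'q, 'n) sym set" where "A0 = range Alpha"
definition A1 :: "('p, 'q, 'n) sym set" where "A1 = range Beta"

definition free_map :: "('g \<Rightarrow> 'h) \<Rightarrow> 'g free_alg \<Rightarrow> 'h free_alg" where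
  "free_map h p = (\<Sum>w\<in>Poly_Mapping.keys p. Poly_Mapping.single (map h w) (Poly_Mapping.lookup p w))"

lemma free_map_zero [simp]: "free_map h 0 = 0"
  by (simp add: free_map_def)

lemma free_map_add: "free_map h (p + q) = free_map h p + free_map h q"
  unfolding free_map_def by (rule sum_keys_add) (simp_all add: single_add)

lemma free_map_single [simp]:
  "free_map h (Poly_Mapping.single w c) = Poly_Mapping.single (map h w) c"
  by (cases "c = 0") (simp_all add: free_map_def)

lemma free_map_uminus: "free_map h (- p) = - free_map h p"
  by (metis add.right_inverse add_eq_0_iff free_map_add free_map_zero)

lemma free_map_diff: "free_map h (p - q) = free_map h p - free_map h q"
  by (metis diff_add_cancel eq_diff_eq free_map_add)

lemma free_map_mult: "free_map h (p * q) = free_map h p * free_map h q"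
proof (induction p rule: poly_mapping_add_induct)
  case (single v c)
  show ?case
    by (induction q rule: poly_mapping_add_induct)
      (simp_all add: mult_single plus_list_def distrib_left free_map_add)
qed (simp_all add: distrib_right free_map_add)

text \<open>The canonical map of \<open>U(gl(n))\<close> into \<open>U(gl(m\<^sub>0|m\<^sub>1+n))\<close>, by which \<open>U(gl(n))\<close> is
  identified with a subalgebra.\<close>

lift_definition gl_incl :: "'n Ugln \<Rightarrow> ('p, 'q, 'n) sym Ugl"
  is "free_map (map_prod Low Low)"
proof -
  fix p q :: "('n proper \<times> 'n proper) free_alg"
  let ?h = "map_prod Low Low :: _ \<Rightarrow> ('p, 'q, 'n) sym \<times> ('p, 'q, 'n) sym"
  assume "gl_eq p q"
  then have "p - q \<in> two_sided_ideal {gl_relator x y | x y. True}"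
    by (simp add: gl_eq_def gl_ideal_def)
  then have "free_map ?h (p - q) \<in> gl_ideal"
  proof (rule two_sided_ideal_least)
    fix r s t :: "('n proper \<times> 'n proper) free_alg"
    assume "s \<in> {gl_relator x y |x y. True}"
    then obtain x y where s: "s = gl_relator x y" by blast
    have "free_map ?h s = gl_relator (?h x) (?h y)"
      unfolding s gl_relator_def superbracket_def super_sign_def fgen_def
      by (cases x; cases y)
        (auto simp: free_map_diff mult_single parity_sym_def zero_list_def plus_list_def)
    then have "free_map ?h s \<in> {gl_relator x y |x y. True}"
      by blast
    then show "free_map ?h (r * s * t) \<in> gl_ideal"
      unfolding gl_ideal_def free_map_mult by (rule two_sided_ideal.gen)
  qed (simp_all add: free_map_add gl_ideal_def two_sided_ideal.zero two_sided_ideal.add)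
  then show "gl_eq (free_map ?h p) (free_map ?h q)"
    by (simp add: gl_eq_def free_map_diff)
qed

lemma gl_incl_hom:
  "gl_incl (Ue i j) = Ue (Low i) (Low j)"
  "gl_incl (Uscalar c) = Uscalar c"
  "gl_incl (u + v) = gl_incl u + gl_incl v"
  "gl_incl (u * v) = gl_incl u * gl_incl v"
  by (transfer, simp add: fgen_def free_map_add free_map_mult zero_list_def gl_eq_refl)+


section \<open>The ideal of irregular products and the devirtualization projection\<close>

text \<open>
  The list \<open>[(a\<^sub>m, b\<^sub>m), \<dots>, (a\<^sub>1, b\<^sub>1)]\<close> encodes the product \<open>e\<^bsub>a_m,b_m\<^esub> \<cdots> e\<^bsub>a_1,b_1\<^esub>\<close>;
  the numbering runs from right to left, hence the reversal.
\<close>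

definition irregular_word :: "(('p, 'q, 'n) sym \<times> ('p, 'q, 'n) sym) list \<Rightarrow> bool" where
  "irregular_word w \<longleftrightarrow> (\<exists>i \<in> {1..length w}. \<exists>\<gamma> \<in> A0 \<union> A1.
     count_list (map snd (take i (rev w))) \<gamma> > count_list (map fst (take (i - 1) (rev w))) \<gamma>)"

definition Irr :: "('p, 'q, 'n) sym Ugl set" where
  "Irr = left_ideal {prod_list (map (\<lambda>(a, b). Ue a b) w) | w. irregular_word w}"

definition Virt :: "('p, 'q, 'n) sym Ugl set" where
  "Virt = {gl_incl u + x | u x. x \<in> Irr}"

text \<open>
  The projection of \<open>Virt = U(gl(n)) \<oplus> Irr\<close> onto \<open>U(gl(n))\<close> along \<open>Irr\<close>. The element chosen
  is unique for arguments in \<open>Virt\<close>, since \<open>gl_incl\<close> is injective (PBW) and its range meets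
  \<open>Irr\<close> only in \<open>0\<close>; outside \<open>Virt\<close> the value is unspecified.
\<close>

definition devirt :: "('p, 'q, 'n) sym Ugl \<Rightarrow> 'n Ugln" where
  "devirt x = (SOME u. x - gl_incl u \<in> Irr)"

lemma devirt:
  assumes "x \<in> Virt"
  shows "x - gl_incl (devirt x) \<in> Irr"
proof -
  obtain u y where "x = gl_incl u + y" "y \<in> Irr"
    using assms unfolding Virt_def by blast
  then have "x - gl_incl u \<in> Irr"
    by simp
  then show ?thesis
    unfolding devirt_def by (rule someI)
qed

definition column_capelli :: "('p, 'q, 'n) sym list \<Rightarrow> 'n list \<Rightarrow> 'n list \<Rightarrow> 'n Ugln" where
  "column_capelli \<alpha>s rs cs = devirt
     (prod_list (map2 (\<lambda>i \<alpha>. Ue (Low (Proper i)) \<alpha>) rs \<alpha>s)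
      * prod_list (map2 (\<lambda>\<alpha> j. Ue \<alpha> (Low (Proper j))) \<alpha>s cs))"


section \<open>The polynomial algebra \<open>\<complex>[M\<^sub>n\<^sub>,\<^sub>d]\<close> and its \<open>gl(n)\<close>-action\<close>

text \<open>Exponent vectors are finitely supported maps from the variables \<open>(i|\<phi>)\<close> to \<open>nat\<close>.\<close>

type_synonym ('n, 'd) polyM = "(('n \<times> 'd) \<Rightarrow>\<^sub>0 nat) \<Rightarrow>\<^sub>0 complex"

definition Const :: "complex \<Rightarrow> ('n, 'd) polyM" where
  "Const c = Poly_Mapping.single 0 c"

definition X :: "'n \<Rightarrow> 'd \<Rightarrow> ('n, 'd) polyM" where
  "X i \<phi> = Poly_Mapping.single (Poly_Mapping.single (i, \<phi>) 1) 1"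

definition pderivM :: "'n \<Rightarrow> 'd \<Rightarrow> ('n, 'd) polyM \<Rightarrow> ('n, 'd) polyM" where
  "pderivM i \<phi> f = (\<Sum>m\<in>Poly_Mapping.keys f.
     Poly_Mapping.single (m - Poly_Mapping.single (i, \<phi>) 1)
       (Poly_Mapping.lookup f m * of_nat (Poly_Mapping.lookup m (i, \<phi>))))"

definition derivation :: "(('n, 'd) polyM \<Rightarrow> ('n, 'd) polyM) \<Rightarrow> bool" where
  "derivation D \<longleftrightarrow> (\<forall>f g. D (f + g) = D f + D g) \<and> (\<forall>c f. D (Const c * f) = Const c * D f)
     \<and> (\<forall>f g. D (f * g) = D f * g + f * D g)"

definition polarization :: "'n \<Rightarrow> 'n \<Rightarrow> ('n, 'd) polyM \<Rightarrow> ('n, 'd) polyM" where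
  "polarization i j = (THE D. derivation D \<and> (\<forall>k \<phi>. D (X k \<phi>) = (if k = j then X i \<phi> else 0)))"

lemma Const_simps [simp]: "Const 0 = 0" "Const 1 = 1"
  by (simp_all add: Const_def)

lemma Const_add: "Const (c + d) = Const c + Const d"
  by (simp add: Const_def single_add)

lemma Const_mult: "Const (c * d) = Const c * Const d"
  by (simp add: Const_def mult_single)

lemma pderivM_add: "pderivM i \<phi> (f + g) = pderivM i \<phi> f + pderivM i \<phi> g"
  unfolding pderivM_def
  by (rule sum_keys_add) (simp_all add: distrib_right single_add)

lemma pderivM_zero [simp]: "pderivM i \<phi> 0 = 0"
  by (simp add: pderivM_def)

lemma pderivM_single:
  "pderivM i \<phi> (Poly_Mapping.single m c) =
     Poly_Mapping.single (m - Poly_Mapping.single (i, \<phi>) 1) (c * of_nat (Poly_Mapping.lookup m (i, \<phi>)))"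
  by (cases "c = 0") (simp_all add: pderivM_def)

lemma exponent_diff_add:
  fixes m m' :: "'v \<Rightarrow>\<^sub>0 nat"
  assumes "Poly_Mapping.lookup m v \<noteq> 0"
  shows "m + m' - Poly_Mapping.single v 1 = (m - Poly_Mapping.single v 1) + m'"
  using assms
  by (intro poly_mapping_eqI) (auto simp: lookup_add lookup_minus lookup_single when_def)

lemma pderivM_mult_single:
  "pderivM i \<phi> (Poly_Mapping.single m c * Poly_Mapping.single m' c') =
     pderivM i \<phi> (Poly_Mapping.single m c) * Poly_Mapping.single m' c'
     + Poly_Mapping.single m c * pderivM i \<phi> (Poly_Mapping.single m' c')"
  using exponent_diff_add[of m "(i, \<phi>)" m'] exponent_diff_add[of m' "(i, \<phi>)" m]
  by (cases "Poly_Mapping.lookup m (i, \<phi>) = 0"; cases "Poly_Mapping.lookup m' (i, \<phi>) = 0")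
    (simp_all add: mult_single pderivM_single lookup_add algebra_simps flip: single_add)

lemma pderivM_mult:
  "pderivM i \<phi> (f * g) = pderivM i \<phi> f * g + f * pderivM i \<phi> g"
proof (induction f rule: poly_mapping_add_induct)
  case (single m c)
  show ?case
    by (induction g rule: poly_mapping_add_induct)
      (simp_all add: pderivM_mult_single distrib_left pderivM_add algebra_simps)
qed (simp_all add: pderivM_add algebra_simps)

lemma pderivM_Const: "pderivM i \<phi> (Const c) = 0"
  by (simp add: Const_def pderivM_single)

lemma derivation_pderivM: "derivation (pderivM i \<phi>)"
  by (simp add: derivation_def pderivM_add pderivM_mult pderivM_Const)

lemma pderivM_X: "pderivM i \<phi> (X k \<psi>) = (if k = i \<and> \<psi> = \<phi> then 1 else 0)"
  by (auto simp: X_def pderivM_single lookup_single when_def)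

lemma derivation_zero: "derivation D \<Longrightarrow> D 0 = 0"
  unfolding derivation_def by (metis add_cancel_right_right add.right_neutral)

lemma derivation_Const:
  assumes "derivation D"
  shows "D (Const c) = 0"
proof -
  have "D (1 * 1) = D 1 * 1 + 1 * D 1"
    using assms unfolding derivation_def by blast
  then have "D 1 = 0"
    by simp
  moreover have "D (Const c * 1) = Const c * D 1"
    using assms unfolding derivation_def by blast
  ultimately show ?thesis
    by simp
qed

lemma derivation_unique:
  assumes D: "derivation D" "derivation E" and eq: "\<And>k \<phi>. D (X k \<phi>) = E (X k \<phi>)"
  shows "D = E"
proof
  have mult: "D (f * g) = E (f * g)" if "D f = E f" "D g = E g" for f g
    using D that unfolding derivation_def by simp
  have add: "D (f + g) = E (f + g)" if "D f = E f" "D g = E g" for f g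
    using D that unfolding derivation_def by simp
  have Const: "D (Const c) = E (Const c)" for c
    using D by (simp add: derivation_Const)
  have power: "D (Poly_Mapping.single (Poly_Mapping.single v a) 1)
      = E (Poly_Mapping.single (Poly_Mapping.single v a) 1)" for v and a :: nat
  proof (induction a)
    case 0
    then show ?case
      using Const[of 1] by (simp add: Const_def)
  next
    case (Suc a)
    obtain k \<phi> where v: "v = (k, \<phi>)" by fastforce
    have "Poly_Mapping.single (Poly_Mapping.single v (Suc a)) 1
        = X k \<phi> * Poly_Mapping.single (Poly_Mapping.single v a) 1"
      by (simp add: X_def v mult_single flip: single_add)
    then show ?case
      using mult eq Suc by metis
  qed
  have monom: "D (Poly_Mapping.single m 1) = E (Poly_Mapping.single m 1)" for m
  proof (induction m rule: poly_mapping_add_induct)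
    case zero
    then show ?case
      using Const[of 1] by (simp add: Const_def)
  next
    case (add m m')
    then show ?case
      using mult[OF add] by (simp add: mult_single)
  qed (rule power)
  show "D f = E f" for f
  proof (induction f rule: poly_mapping_add_induct)
    case zero
    then show ?case
      using Const[of 0] by simp
  next
    case (single m c)
    then show ?case
      using mult[OF Const[of c] monom[of m]] by (simp add: Const_def mult_single)
  qed (rule add)
qed

lemma polarization_unique:
  "\<exists>!D :: ('n, 'd::finite) polyM \<Rightarrow> _.
     derivation D \<and> (\<forall>k \<phi>. D (X k \<phi>) = (if k = j then X i \<phi> else 0))"
proof (rule ex_ex1I)
  let ?D = "\<lambda>f :: ('n, 'd) polyM. \<Sum>\<phi>\<in>UNIV. X i \<phi> * pderivM j \<phi> f"
  have "derivation ?D"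
    by (simp add: derivation_def pderivM_add pderivM_mult pderivM_Const distrib_left
        sum.distrib sum_distrib_left sum_distrib_right mult.assoc mult.left_commute)
  moreover have "?D (X k \<phi>) = (if k = j then X i \<phi> else 0)" for k \<phi>
    by (simp add: pderivM_X if_distrib cong: if_cong)
  ultimately show "\<exists>D :: ('n, 'd) polyM \<Rightarrow> _.
     derivation D \<and> (\<forall>k \<phi>. D (X k \<phi>) = (if k = j then X i \<phi> else 0))"
    by blast
qed (auto intro!: derivation_unique)

lemma polarization:
  "derivation (polarization i j :: ('n, 'd::finite) polyM \<Rightarrow> _)"
  "polarization i j (X k \<phi> :: ('n, 'd) polyM) = (if k = j then X i \<phi> else 0)"
  using theI'[OF polarization_unique[of j i]] unfolding polarization_def by blast+

lemma polarization_eq: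
  "polarization i j (f :: ('n, 'd::finite) polyM) = (\<Sum>\<phi>\<in>UNIV. X i \<phi> * pderivM j \<phi> f)"
proof -
  have "derivation (\<lambda>f :: ('n, 'd) polyM. \<Sum>\<phi>\<in>UNIV. X i \<phi> * pderivM j \<phi> f)"
    by (simp add: derivation_def pderivM_add pderivM_mult pderivM_Const distrib_left
        sum.distrib sum_distrib_left sum_distrib_right mult.assoc mult.left_commute)
  then have "polarization i j = (\<lambda>f :: ('n, 'd) polyM. \<Sum>\<phi>\<in>UNIV. X i \<phi> * pderivM j \<phi> f)"
    by (intro derivation_unique polarization)
      (auto simp: polarization pderivM_X if_distrib cong: if_cong)
  then show ?thesis by simp
qed

definition free_act :: "('g \<Rightarrow> ('n, 'd) polyM \<Rightarrow> ('n, 'd) polyM)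
    \<Rightarrow> 'g free_alg \<Rightarrow> ('n, 'd) polyM \<Rightarrow> ('n, 'd) polyM" where
  "free_act T p f = (\<Sum>w\<in>Poly_Mapping.keys p. Const (Poly_Mapping.lookup p w) * foldr T w f)"

lemma free_act_zero [simp]: "free_act T 0 f = 0"
  by (simp add: free_act_def)

lemma free_act_add: "free_act T (p + q) f = free_act T p f + free_act T q f"
  unfolding free_act_def by (rule sum_keys_add) (simp_all add: Const_add distrib_right)

lemma free_act_single: "free_act T (Poly_Mapping.single w c) f = Const c * foldr T w f"
  by (cases "c = 0") (simp_all add: free_act_def)

lemma free_act_diff: "free_act T (p - q) f = free_act T p f - free_act T q f"
  by (metis diff_add_cancel eq_diff_eq free_act_add)

context
  fixes T :: "'g \<Rightarrow> ('n, 'd) polyM \<Rightarrow> ('n, 'd) polyM"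
  assumes T_add: "\<And>g f f'. T g (f + f') = T g f + T g f'"
    and T_scale: "\<And>g c f. T g (Const c * f) = Const c * T g f"
begin

lemma foldr_add: "foldr T w (f + f') = foldr T w f + foldr T w f'"
  by (induction w) (simp_all add: T_add)

lemma foldr_scale: "foldr T w (Const c * f) = Const c * foldr T w f"
  by (induction w) (simp_all add: T_scale)

lemma free_act_add_right: "free_act T p (f + f') = free_act T p f + free_act T p f'"
  by (simp add: free_act_def foldr_add distrib_left sum.distrib)

lemma free_act_scale: "free_act T p (Const c * f) = Const c * free_act T p f"
  by (simp add: free_act_def foldr_scale sum_distrib_left mult.left_commute)

lemma foldr_zero: "foldr T w 0 = 0"
  using foldr_scale[of w 0 0] by simp

lemma free_act_zero_right: "free_act T p 0 = 0"
  using free_act_scale[of p 0 0] by simp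

lemma free_act_mult: "free_act T (p * q) f = free_act T p (free_act T q f)"
proof (induction p rule: poly_mapping_add_induct)
  case (single v c)
  show ?case
    by (induction q rule: poly_mapping_add_induct)
      (simp_all add: mult_single plus_list_def distrib_left free_act_add free_act_single
        free_act_add_right free_act_zero_right foldr_add foldr_scale foldr_zero Const_mult
        mult.assoc)
qed (simp_all add: distrib_right free_act_add)

end

lemma derivation_commutator:
  assumes "derivation D" "derivation E"
  shows "derivation (\<lambda>f. D (E f) - E (D f))"
  using derivation_Const[OF assms(1)] derivation_Const[OF assms(2)] assms
  unfolding derivation_def by (simp add: algebra_simps)

lemma derivation_diff:
  assumes "derivation D" "derivation E"
  shows "derivation (\<lambda>f. D f - E f)"
  using derivation_Const[OF assms(1)] derivation_Const[OF assms(2)] assms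
  unfolding derivation_def by (simp add: algebra_simps)

lemma polarization_bracket:
  fixes f :: "('n, 'd::finite) polyM"
  shows "polarization i j (polarization k l f) - polarization k l (polarization i j f)
    = (if j = k then polarization i l f else 0) - (if i = l then polarization k j f else 0)"
proof -
  have zero: "derivation (\<lambda>_ :: ('n, 'd) polyM. 0)"
    by (simp add: derivation_def)
  have if_der: "derivation (\<lambda>f :: ('n, 'd) polyM. if b then polarization i j f else 0)" for b i j
    using zero polarization(1)[of i j] by (cases b) simp_all
  have "(\<lambda>f :: ('n, 'd) polyM.
      polarization i j (polarization k l f) - polarization k l (polarization i j f))
    = (\<lambda>f. (if j = k then polarization i l f else 0) - (if i = l then polarization k j f else 0))"
    by (intro derivation_unique derivation_commutator derivation_diff if_der polarization(1))
      (auto simp: polarization(2) derivation_zero[OF polarization(1)])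
  then show ?thesis
    by meson
qed

text \<open>The action of \<open>U(gl(n))\<close>, in which \<open>e\<^sub>i\<^sub>j\<close> acts as \<open>polarization i j\<close>.\<close>

definition polar_gen :: "'n proper \<times> 'n proper \<Rightarrow> ('n, 'd) polyM \<Rightarrow> ('n, 'd) polyM" where
  "polar_gen = (\<lambda>(Proper i, Proper j) \<Rightarrow> polarization i j)"

lemma polar_gen_linear:
  fixes x :: "'n proper \<times> 'n proper" and f g :: "('n, 'd::finite) polyM"
  shows "polar_gen x (f + g) = polar_gen x f + polar_gen x g"
    and "polar_gen x (Const c * f) = Const c * polar_gen x f"
proof -
  obtain i j where x: "x = (Proper i, Proper j)"
    by (metis proper.exhaust surj_pair)
  have D: "derivation (polarization i j :: ('n, 'd) polyM \<Rightarrow> _)"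
    by (rule polarization(1))
  from D derivation_Const[OF D] show "polar_gen x (f + g) = polar_gen x f + polar_gen x g"
    and "polar_gen x (Const c * f) = Const c * polar_gen x f"
    unfolding derivation_def polar_gen_def x by simp_all
qed

lemmas polar_act_mult = free_act_mult[of polar_gen, OF polar_gen_linear]

lift_definition U_act :: "'n Ugln \<Rightarrow> ('n, 'd::finite) polyM \<Rightarrow> ('n, 'd) polyM"
  is "free_act polar_gen"
proof -
  fix p q :: "('n proper \<times> 'n proper) free_alg"
  assume "gl_eq p q"
  then have "p - q \<in> two_sided_ideal {gl_relator x y | x y. True}"
    by (simp add: gl_eq_def gl_ideal_def)
  then have "\<forall>f :: ('n, 'd) polyM. free_act polar_gen (p - q) f = 0"
  proof (rule two_sided_ideal_least)
    fix r s t :: "('n proper \<times> 'n proper) free_alg"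
    assume "s \<in> {gl_relator x y |x y. True}"
    then obtain x y where s: "s = gl_relator x y" by blast
    obtain i j k l where xy: "x = (Proper i, Proper j)" "y = (Proper k, Proper l)"
      by (metis proper.exhaust surj_pair)
    have "free_act polar_gen s f = 0" for f :: "('n, 'd) polyM"
      using polarization_bracket[of i j k l f]
      unfolding s gl_relator_def superbracket_def super_sign_def fgen_def
      by (auto simp: xy free_act_diff mult_single parity_proper_def zero_list_def
          plus_list_def free_act_single polar_gen_def)
    then show "\<forall>f :: ('n, 'd) polyM. free_act polar_gen (r * s * t) f = 0"
      using free_act_zero_right[of "polar_gen :: _ \<Rightarrow> ('n, 'd) polyM \<Rightarrow> _", OF polar_gen_linear]
      by (simp add: polar_act_mult)
  qed (simp_all add: free_act_add)
  then show "free_act polar_gen p = (free_act polar_gen q :: ('n, 'd) polyM \<Rightarrow> _)"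
    by (auto simp: free_act_diff)
qed

lemma U_act_hom:
  fixes f :: "('n, 'd::finite) polyM"
  shows "U_act (Ue (Proper i) (Proper j)) f = polarization i j f"
    and "U_act (Uscalar c) f = Const c * f"
    and "U_act (u + v) f = U_act u f + U_act v f"
    and "U_act (u * v) f = U_act u (U_act v f)"
  by (simp_all add: Ue.abs_eq Uscalar.abs_eq U_act.abs_eq fgen_def free_act_single polar_gen_def
      zero_list_def)
    (induction u rule: Ugl.abs_induct, induction v rule: Ugl.abs_induct,
      simp add: plus_Ugl.abs_eq times_Ugl.abs_eq U_act.abs_eq free_act_add polar_act_mult)+

end

theory Submission
  imports Defs
begin

text \<open>
  Moving \<open>e\<^bsub>i,\<alpha>\<^esub>\<close> to the right through \<open>e\<^bsub>i_2,\<alpha>_2\<^esub> \<cdots> e\<^bsub>i_h,\<alpha>_h\<^esub> e\<^bsub>\<alpha>,j\<^esub> \<cdots>\<close> and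
  discarding irregular products gives, modulo \<open>Irr\<close>, the recursion
  \<open>C(i,i_2,\<dots>; j,j_2,\<dots>) = (-1)\<^bsup>h-1\<^esup> (e\<^bsub>i,j\<^esub> C(i_2,\<dots>; j_2,\<dots>) - \<Sum>\<^bsub>k: i_k = j\<^esub> C(\<dots>,i,\<dots>; j_2,\<dots>))\<close>,
  with \<open>i\<close> put in place of \<open>i_k\<close>. By the Leibniz rule the normally ordered operators
  \<open>\<Sum> (i_1|\<phi>_1) \<cdots> (i_h|\<phi>_h) \<partial>(j_1|\<phi>_1) \<cdots> \<partial>(j_h|\<phi>_h)\<close> satisfy the same recursion without the sign.

  It remains to see that an element of \<open>U(gl(n))\<close> lying in \<open>Irr\<close> acts as zero. The whole
  superalgebra acts by superderivations on the free superalgebra on letters \<open>(s|\<phi>)\<close>, where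
  an irregular product kills every word in proper letters because it removes a virtual symbol
  that is not there; words in proper letters map onto the monomials of \<open>\<complex>[M\<^sub>n\<^sub>,\<^sub>d]\<close>.
\<close>

section \<open>Scalars\<close>

lemma Const_uminus_one_power: "Const ((- 1) ^ k) = ((- 1) ^ k :: ('n, 'd) polyM)"
proof -
  have "Const (- 1) + 1 = (0 :: ('n, 'd) polyM)"
    using Const_add[of "- 1" 1, where ?'a = 'n and ?'b = 'd] by simp
  then have "Const (- 1) = (- 1 :: ('n, 'd) polyM)"
    by (rule eq_neg_iff_add_eq_0[THEN iffD2])
  then show ?thesis
    by (induction k) (simp_all only: power_0 power_Suc Const_mult Const_simps)
qed

lemma Uscalar_one: "Uscalar 1 = 1"
  by transfer (simp add: gl_eq_refl)

lemma Uscalar_uminus_one: "Uscalar (- 1) = - 1"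
  by transfer (simp add: gl_eq_refl flip: single_uminus single_one)

section \<open>Superderivations acting on functions of words\<close>

text \<open>
  The generator \<open>(a, b)\<close> acts on the free superalgebra over the letters \<open>(s, \<phi>)\<close> as the
  superderivation replacing the symbol \<open>b\<close> by \<open>a\<close>; \<open>word_subst\<close> is the transpose of this
  action. The letter \<open>(s, \<phi>)\<close> has parity \<open>parity s + 1\<close>, so that proper letters are even.
\<close>

fun word_subst :: "'s::graded \<times> 's \<Rightarrow> (('s \<times> 'd) list \<Rightarrow> 'r::comm_ring_1)
    \<Rightarrow> ('s \<times> 'd) list \<Rightarrow> 'r" where
  "word_subst x F [] = 0"
| "word_subst x F (l # w) =
     (if fst l = snd x then F ((fst x, snd l) # w) else 0)
     + (- 1) ^ ((parity (fst x) + parity (snd x)) * Suc (parity (fst l)))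
         * word_subst x (\<lambda>v. F (l # v)) w"

lemma word_subst_add: "word_subst x (\<lambda>v. F v + G v) w = word_subst x F w + word_subst x G w"
  by (induction w arbitrary: F G) (simp_all add: algebra_simps)

lemma word_subst_zero: "word_subst x (\<lambda>v. 0) w = 0"
  by (induction w) simp_all

lemma word_subst_scale: "word_subst x (\<lambda>v. c * F v) w = c * word_subst x F w"
  by (induction w arbitrary: F) (simp_all add: algebra_simps)

text \<open>Transposition reverses composition: the outer substitution changes the word first, so
  the leading term is \<open>e_{a,b} e_{c,d}\<close>. By induction on the word, two changes of the
  head letter give the bracket terms, one in the head and one in the tail cancel, and two in the
  tail fall to the induction hypothesis.\<close>

lemma word_subst_bracket:
  fixes a b c d :: "'s::graded" and F :: "('s \<times> 'd) list \<Rightarrow> 'r::comm_ring_1"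
  defines "\<sigma> \<equiv> (- 1) ^ ((parity a + parity b) * (parity c + parity d))"
  shows "word_subst (c, d) (word_subst (a, b) F) w - \<sigma> * word_subst (a, b) (word_subst (c, d) F) w
    = (if b = c then word_subst (a, d) F w else 0)
      - (if a = d then \<sigma> * word_subst (c, b) F w else 0)"
proof (induction w arbitrary: F)
  case (Cons l w)
  obtain s \<phi> where l: "l = (s, \<phi>)"
    by fastforce
  let ?F = "\<lambda>v. F (l # v)"
  have IH: "word_subst (c, d) (word_subst (a, b) ?F) w
    = \<sigma> * word_subst (a, b) (word_subst (c, d) ?F) w
      + ((if b = c then word_subst (a, d) ?F w else 0)
      - (if a = d then \<sigma> * word_subst (c, b) ?F w else 0))"
    using Cons.IH[of ?F] by (simp add: diff_eq_eq add.commute)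
  define s1 s2 :: 'r
    where s1: "s1 = (- 1) ^ ((parity a + parity b) * Suc (parity s))"
      and s2: "s2 = (- 1) ^ ((parity c + parity d) * Suc (parity s))"
  \<comment> \<open>Once \<open>b\<close> has become \<open>a\<close> in the head,
    \<open>(c, d)\<close> passes a letter whose parity differs by that of \<open>(a, b)\<close>;
    this costs exactly \<open>\<sigma>\<close>.\<close>
  have sign_b: "(- 1) ^ ((parity c + parity d) * Suc (parity a)) = \<sigma> * s2" if "s = b"
    unfolding \<sigma>_def s2 power_add[symmetric] minus_one_power_iff by (simp add: that) blast
  have sign_d: "(- 1) ^ ((parity a + parity b) * Suc (parity c)) = \<sigma> * s1" if "s = d"
    unfolding \<sigma>_def s1 power_add[symmetric] minus_one_power_iff by (simp add: that) blast
  have sign_ad: "(- 1) ^ ((parity a + parity d) * Suc (parity s)) = s1 * s2" if "b = c"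
    unfolding s1 s2 power_add[symmetric] minus_one_power_iff by (simp add: that) blast
  have sign_cb: "(- 1) ^ ((parity c + parity b) * Suc (parity s)) = s1 * s2" if "a = d"
    unfolding s1 s2 power_add[symmetric] minus_one_power_iff by (simp add: that) blast
  have \<sigma>: "\<sigma> * (\<sigma> * z) = z" for z
    by (simp add: \<sigma>_def flip: power_add mult.assoc mult_2)
  have ab: "word_subst (a, b) G ((u, \<phi>) # v) = (if u = b then G ((a, \<phi>) # v) else 0)
      + (- 1) ^ ((parity a + parity b) * Suc (parity u)) * word_subst (a, b) (\<lambda>v. G ((u, \<phi>) # v)) v"
    and cd: "word_subst (c, d) G ((u, \<phi>) # v) = (if u = d then G ((c, \<phi>) # v) else 0)
      + (- 1) ^ ((parity c + parity d) * Suc (parity u)) * word_subst (c, d) (\<lambda>v. G ((u, \<phi>) # v)) v"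
    for u v and G :: "('s \<times> 'd) list \<Rightarrow> 'r"
    by simp_all
  have if_subst: "word_subst x (\<lambda>v. if Q then G v else 0) v = (if Q then word_subst x G v else 0)"
    for x Q v and G :: "('s \<times> 'd) list \<Rightarrow> 'r"
    by (simp add: word_subst_zero)
  have cdab: "word_subst (c, d) (word_subst (a, b) F) (l # w)
    = (if s = d then (if b = c then F ((a, \<phi>) # w) else 0)
        + \<sigma> * (s1 * word_subst (a, b) (\<lambda>v. F ((c, \<phi>) # v)) w) else 0)
      + s2 * ((if s = b then word_subst (c, d) (\<lambda>v. F ((a, \<phi>) # v)) w else 0)
        + s1 * word_subst (c, d) (word_subst (a, b) ?F) w)"
    unfolding l cd[of _ s] ab s2[symmetric] s1[symmetric] word_subst_add word_subst_scale if_subst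
    by (auto simp: sign_d mult.assoc simp del: mult_Suc_right)
  have abcd: "word_subst (a, b) (word_subst (c, d) F) (l # w)
    = (if s = b then (if a = d then F ((c, \<phi>) # w) else 0)
        + \<sigma> * (s2 * word_subst (c, d) (\<lambda>v. F ((a, \<phi>) # v)) w) else 0)
      + s1 * ((if s = d then word_subst (a, b) (\<lambda>v. F ((c, \<phi>) # v)) w else 0)
        + s2 * word_subst (a, b) (word_subst (c, d) ?F) w)"
    unfolding l ab[of _ s] cd s2[symmetric] s1[symmetric] word_subst_add word_subst_scale if_subst
    by (auto simp: sign_b mult.assoc simp del: mult_Suc_right)
  have ad: "(if b = c then word_subst (a, d) F (l # w) else 0)
    = (if b = c then (if s = d then F ((a, \<phi>) # w) else 0) + s1 * s2 * word_subst (a, d) ?F w else 0)"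
    by (simp add: l sign_ad del: mult_Suc_right)
  have cb: "(if a = d then \<sigma> * word_subst (c, b) F (l # w) else 0)
    = (if a = d then \<sigma> * ((if s = b then F ((c, \<phi>) # w) else 0) + s1 * s2 * word_subst (c, b) ?F w) else 0)"
    by (simp add: l sign_cb del: mult_Suc_right)
  show ?case
    unfolding cdab abcd ad cb IH
    by (cases "s = b"; cases "s = d"; cases "b = c"; cases "a = d")
      (simp_all only: if_True if_False simp_thms, simp_all add: algebra_simps \<sigma>)
qed simp

text \<open>Transposition makes this a right action: the first letter of a product acts first.\<close>

definition word_act :: "('s::graded \<times> 's) free_alg \<Rightarrow> (('s \<times> 'e) list \<Rightarrow> ('n, 'd) polyM)
    \<Rightarrow> ('s \<times> 'e) list \<Rightarrow> ('n, 'd) polyM" where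
  "word_act p F w =
     (\<Sum>v\<in>Poly_Mapping.keys p. Const (Poly_Mapping.lookup p v) * foldl (\<lambda>F x. word_subst x F) F v w)"

lemma word_act_zero [simp]: "word_act 0 F w = 0"
  by (simp add: word_act_def)

lemma word_act_add: "word_act (p + q) F w = word_act p F w + word_act q F w"
  unfolding word_act_def by (rule sum_keys_add) (simp_all add: Const_add distrib_right)

lemma word_act_single:
  "word_act (Poly_Mapping.single v c) F w = Const c * foldl (\<lambda>F x. word_subst x F) F v w"
  by (cases "c = 0") (simp_all add: word_act_def)

lemma word_act_diff: "word_act (p - q) F w = word_act p F w - word_act q F w"
  by (metis diff_add_cancel eq_diff_eq word_act_add)

lemma foldl_word_subst_add:
  "foldl (\<lambda>F x. word_subst x F) (\<lambda>w. F w + G w) v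
    = (\<lambda>w. foldl (\<lambda>F x. word_subst x F) F v w + foldl (\<lambda>F x. word_subst x F) G v w)"
  by (induction v arbitrary: F G) (simp_all add: word_subst_add[abs_def])

lemma foldl_word_subst_scale:
  "foldl (\<lambda>F x. word_subst x F) (\<lambda>w. c * F w) v
    = (\<lambda>w. c * foldl (\<lambda>F x. word_subst x F) F v w)"
  by (induction v arbitrary: F) (simp_all add: word_subst_scale[abs_def])

lemma foldl_word_subst_zero: "foldl (\<lambda>F x. word_subst x F) (\<lambda>w. 0) v = (\<lambda>w. 0)"
  by (induction v) (simp_all add: word_subst_zero[abs_def])

lemma word_act_add_right: "word_act p (\<lambda>w. F w + G w) w = word_act p F w + word_act p G w"
  by (simp add: word_act_def foldl_word_subst_add distrib_left sum.distrib)

lemma word_act_scale: "word_act p (\<lambda>w. c * F w) w = c * word_act p F w"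
  by (simp add: word_act_def foldl_word_subst_scale sum_distrib_left mult.left_commute)

lemma word_act_zero_right: "word_act p (\<lambda>w. 0) w = 0"
  by (simp add: word_act_def foldl_word_subst_zero)

lemma word_act_mult: "word_act (p * q) F w = word_act q (word_act p F) w"
proof (induction p rule: poly_mapping_add_induct)
  case zero
  show ?case
    by (simp add: word_act_def foldl_word_subst_zero)
next
  case (single v c)
  show ?case
    by (induction q rule: poly_mapping_add_induct)
      (simp_all add: mult_single plus_list_def distrib_left word_act_add word_act_single
        [abs_def] foldl_word_subst_scale Const_mult mult_ac)
next
  case (add p p')
  have "word_act (p + p') F = (\<lambda>w. word_act p F w + word_act p' F w)"
    by (simp add: word_act_add fun_eq_iff)
  with add show ?case
    by (simp add: distrib_right word_act_add word_act_add_right)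
qed

text \<open>Well defined because relators annihilate every function, by
  \<open>word_subst_bracket\<close>: in \<open>r * s * t\<close> the factor \<open>r\<close> only
  changes the function, and \<open>t\<close> then acts on zero.\<close>

lift_definition Ugl_word_act :: "'s::graded Ugl \<Rightarrow> (('s \<times> 'e) list \<Rightarrow> ('n, 'd) polyM)
    \<Rightarrow> ('s \<times> 'e) list \<Rightarrow> ('n, 'd) polyM" is word_act
proof -
  fix p q :: "('s \<times> 's) free_alg"
  assume "gl_eq p q"
  then have "p - q \<in> two_sided_ideal {gl_relator x y | x y. True}"
    by (simp add: gl_eq_def gl_ideal_def)
  then have "\<forall>(F :: ('s \<times> 'e) list \<Rightarrow> ('n, 'd) polyM) w. word_act (p - q) F w = 0"
  proof (rule two_sided_ideal_least)
    fix r s t :: "('s \<times> 's) free_alg"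
    assume "s \<in> {gl_relator x y |x y. True}"
    then obtain a b c d where s: "s = gl_relator (a, b) (c, d)"
      by force
    have "word_act s F = (\<lambda>w. 0)" for F :: "('s \<times> 'e) list \<Rightarrow> ('n, 'd) polyM"
    proof
      fix w
      let ?k = "(parity a + parity b) * (parity c + parity d)"
      have gen: "word_act (fgen x) F w = word_subst x F w" for x
        by (simp add: fgen_def word_act_single)
      have scale: "word_act (Poly_Mapping.single 0 (super_sign (a, b) (c, d)) * p) F w
          = (- 1) ^ ?k * word_act p F w" for p
        by (simp add: word_act_mult word_act_single[abs_def] zero_list_def super_sign_def
            Const_uminus_one_power word_act_scale)
      have gen2: "word_act (fgen x * fgen y) F w = word_subst y (word_subst x F) w" for x y
        by (simp add: fgen_def mult_single plus_list_def word_act_single)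
      show "word_act s F w = 0"
        unfolding s gl_relator_def superbracket_def word_act_diff scale gen2 prod.case
          if_distrib[of "\<lambda>p. word_act p F w"] gen word_act_zero
        using word_subst_bracket[of c d a b F w] by (subst right_minus_eq)
    qed
    then show "\<forall>(F :: ('s \<times> 'e) list \<Rightarrow> ('n, 'd) polyM) w. word_act (r * s * t) F w = 0"
      by (simp add: word_act_mult[abs_def] word_act_zero_right)
  qed (simp_all add: word_act_add)
  then show "word_act p = (word_act q :: (('s \<times> 'e) list \<Rightarrow> ('n, 'd) polyM) \<Rightarrow> _)"
    by (simp add: word_act_diff fun_eq_iff)
qed

lemma Ugl_word_act_hom:
  shows "Ugl_word_act 0 F w = 0"
    and "Ugl_word_act 1 F w = F w"
    and "Ugl_word_act (Ue a b) F w = word_subst (a, b) F w"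
    and "Ugl_word_act (u + v) F w = Ugl_word_act u F w + Ugl_word_act v F w"
    and "Ugl_word_act (u * v) F w = Ugl_word_act v (Ugl_word_act u F) w"
  by (simp_all add: zero_Ugl.abs_eq one_Ugl.abs_eq Ue.abs_eq Ugl_word_act.abs_eq fgen_def
      word_act_single zero_list_def flip: single_one)
    (induction u rule: Ugl.abs_induct, induction v rule: Ugl.abs_induct,
      simp add: plus_Ugl.abs_eq times_Ugl.abs_eq Ugl_word_act.abs_eq word_act_add word_act_mult)+

section \<open>Irregular products annihilate proper words\<close>

text \<open>A substitution evaluates \<open>F\<close> only at words whose symbol counts are those of
  \<open>w\<close> after one \<open>b\<close> has become \<open>a\<close>. \<open>of_bool\<close>
  stands on both sides to avoid truncated subtraction.\<close>

lemma word_subst_eq_zero: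
  fixes F :: "('s::graded \<times> 'd) list \<Rightarrow> 'r::comm_ring_1"
  assumes "\<And>v. \<lbrakk>count_list (map fst w) b \<ge> 1;
      \<And>\<gamma>. count_list (map fst v) \<gamma> + of_bool (\<gamma> = b) = count_list (map fst w) \<gamma> + of_bool (\<gamma> = a)\<rbrakk>
    \<Longrightarrow> F v = 0"
  shows "word_subst (a, b) F w = 0"
  using assms
proof (induction w arbitrary: F)
  case (Cons l w)
  have "F ((a, snd l) # w) = 0" if "fst l = b"
    by (rule Cons.prems) (use that in auto)
  moreover have "word_subst (a, b) (\<lambda>v. F (l # v)) w = 0"
  proof (rule Cons.IH)
    fix v :: "('s \<times> 'd) list"
    assume *: "count_list (map fst w) b \<ge> 1"
      "\<And>\<gamma>. count_list (map fst v) \<gamma> + of_bool (\<gamma> = b) = count_list (map fst w) \<gamma> + of_bool (\<gamma> = a)"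
    have "count_list (map fst (l # v)) \<gamma> + of_bool (\<gamma> = b)
        = count_list (map fst (l # w)) \<gamma> + of_bool (\<gamma> = a)" for \<gamma>
      using *(2)[of \<gamma>] by auto
    then show "F (l # v) = 0"
      using *(1) by (intro Cons.prems) auto
  qed
  ultimately show ?case
    by simp
qed simp

text \<open>The head of \<open>u\<close> changes the word first. If the first \<open>i\<close>
  factors consume more copies of \<open>\<gamma>\<close> than \<open>w\<close> holds and the first
  \<open>i - 1\<close> factors create, some factor finds none. The count in \<open>w\<close> is kept
  because the word changes along the induction.\<close>

lemma foldr_word_subst_eq_zero:
  fixes F :: "('s::graded \<times> 'd) list \<Rightarrow> 'r::comm_ring_1"
  assumes "i \<in> {1..length u}"
    and "count_list (map snd (take i u)) \<gamma>
      > count_list (map fst (take (i - 1) u)) \<gamma> + count_list (map fst w) \<gamma>"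
  shows "foldr word_subst u F w = 0"
  using assms
proof (induction u arbitrary: i w)
  case (Cons x u)
  obtain a b where x: "x = (a, b)"
    by fastforce
  have "word_subst (a, b) (foldr word_subst u F) w = 0"
  proof (rule word_subst_eq_zero)
    fix v :: "('s \<times> 'd) list"
    assume b: "count_list (map fst w) b \<ge> 1"
      and v: "\<And>\<gamma>. count_list (map fst v) \<gamma> + of_bool (\<gamma> = b)
        = count_list (map fst w) \<gamma> + of_bool (\<gamma> = a)"
    obtain i' where i: "i = Suc i'"
      using Cons.prems(1) by (cases i) auto
    \<comment> \<open>For \<open>i = 1\<close> the excess forces \<open>b = \<gamma>\<close> with no
      such symbol in \<open>w\<close>, contradicting \<open>b\<close>.\<close>
    have "i' \<noteq> 0"
      using Cons.prems(2) b by (intro notI) (simp add: i x split: if_splits)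
    then obtain i'' where i': "i' = Suc i''"
      by (cases i') auto
    show "foldr word_subst u F v = 0"
      using Cons.prems v[of \<gamma>] by (intro Cons.IH[of i']) (auto simp: i i' x split: if_splits)
  qed
  then show ?case
    by (simp add: x)
qed simp

definition proper_word :: "(('p, 'q, 'n) sym \<times> 'd) list \<Rightarrow> bool" where
  "proper_word w \<longleftrightarrow> fst ` set w \<subseteq> range Low"

lemma Ugl_word_act_prod_list:
  "Ugl_word_act (prod_list (map (\<lambda>(a, b). Ue a b) v)) F w = foldl (\<lambda>F x. word_subst x F) F v w"
proof (induction v arbitrary: F)
  case (Cons x v)
  then show ?case
    by (cases x) (simp add: Ugl_word_act_hom Ugl_word_act_hom(3)[abs_def])
qed (simp add: Ugl_word_act_hom)

text \<open>In \<open>r * s\<close> the irregular factor \<open>s\<close> changes the word first and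
  meets no virtual symbol in \<open>w\<close>. It vanishes there for every function
  \<open>G\<close>, hence also for the one produced by \<open>r\<close>; this is why a left ideal is
  handled.\<close>

lemma Irr_word_act:
  assumes "x \<in> Irr" and w: "proper_word w"
  shows "Ugl_word_act x F w = 0"
  using assms(1) unfolding Irr_def
proof induction
  case (gen s r)
  then obtain v where s: "s = prod_list (map (\<lambda>(a, b). Ue a b) v)" and "irregular_word v"
    by blast
  then obtain i \<gamma> where "i \<in> {1..length v}" and \<gamma>: "\<gamma> \<in> A0 \<union> A1"
    and "count_list (map snd (take i (rev v))) \<gamma> > count_list (map fst (take (i - 1) (rev v))) \<gamma>"
    unfolding irregular_word_def by blast
  moreover have "count_list (map fst w) \<gamma> = 0"
    using w \<gamma> by (auto simp: count_list_0_iff proper_word_def A0_def A1_def)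
  ultimately have "foldr word_subst (rev v) G w = 0" for G
    by (intro foldr_word_subst_eq_zero[of i _ \<gamma>]) simp_all
  then show ?case
    by (simp add: Ugl_word_act_hom s Ugl_word_act_prod_list foldl_conv_foldr)
qed (simp_all add: Ugl_word_act_hom)

section \<open>The action of \<open>U(gl(n))\<close> is determined modulo irregular elements\<close>

text \<open>Proper letters are even, so proper words can be read in the commutative ring; virtual
  letters get the default value 0.\<close>

definition word_eval :: "(('p, 'q, 'n) sym \<times> 'd) list \<Rightarrow> ('n, 'd) polyM" where
  "word_eval w = prod_list (map (\<lambda>(s, \<phi>). case s of Low (Proper k) \<Rightarrow> X k \<phi> | _ \<Rightarrow> 0) w)"

lemma word_eval_simps [simp]:
  "word_eval [] = 1"
  "word_eval ((Low (Proper k), \<phi>) # w) = X k \<phi> * word_eval w"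
  "word_eval (v @ w) = word_eval v * word_eval w"
  by (simp_all add: word_eval_def)

lemma polarization_one: "polarization i j 1 = (0 :: ('n, 'd::finite) polyM)"
  using derivation_Const[OF polarization(1)[of i j, where 'd = 'd], of 1] by simp

lemma polarization_mult:
  fixes f g :: "('n, 'd::finite) polyM"
  shows "polarization i j (f * g) = polarization i j f * g + f * polarization i j g"
  using polarization(1)[of i j] unfolding derivation_def by blast

text \<open>The additive map \<open>L\<close> serves the induction: fixing the first letter of the
  argument of \<open>F\<close> turns \<open>L\<close> into \<open>L\<close> after multiplication by
  a variable. No signs appear, as \<open>e_{i,j}\<close> with both indices proper is even.\<close>

lemma word_subst_proper:
  fixes F :: "(('p, 'q, 'n) sym \<times> 'd::finite) list \<Rightarrow> ('n, 'd) polyM"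
  assumes "proper_word w" and "\<And>v. proper_word v \<Longrightarrow> F v = L (word_eval v)"
    and "\<And>f g. L (f + g) = L f + L g" and "L 0 = 0"
  shows "word_subst (Low (Proper i), Low (Proper j)) F w = L (polarization i j (word_eval w))"
  using assms
proof (induction w arbitrary: F L)
  case Nil
  then show ?case
    by (simp add: polarization_one)
next
  case (Cons l w)
  obtain k \<phi> where l: "l = (Low (Proper k), \<phi>)"
    using Cons.prems(1) by (cases l) (auto simp: proper_word_def intro: proper.exhaust)
  have w: "proper_word w"
    using Cons.prems(1) by (simp add: proper_word_def)
  have "word_subst (Low (Proper i), Low (Proper j)) (\<lambda>v. F (l # v)) w
      = L (X k \<phi> * polarization i j (word_eval w))"
    by (rule Cons.IH[where L = "\<lambda>f. L (X k \<phi> * f)"])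
      (use Cons.prems w in \<open>auto simp: l distrib_left proper_word_def\<close>)
  moreover have "F ((Low (Proper i), \<phi>) # w) = L (X i \<phi> * word_eval w)"
    using Cons.prems(1,2) by (simp add: proper_word_def)
  ultimately show ?case
    using Cons.prems(3,4) by (simp add: l polarization_mult polarization(2) parity_sym_def parity_proper_def)
qed

text \<open>Induction from the right end, since the last factor reaches the word first; the
  remaining factors \<open>foldr polar_gen v\<close> play the part of \<open>L\<close>.\<close>

lemma foldl_word_subst_proper:
  fixes w :: "(('p, 'q, 'n) sym \<times> 'd::finite) list"
  assumes "proper_word w"
  shows "foldl (\<lambda>F x. word_subst x F) word_eval (map (map_prod Low Low) v) w
    = foldr polar_gen v (word_eval w)"
  using assms
proof (induction v arbitrary: w rule: rev_induct)
  case (snoc x v)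
  obtain i j where x: "x = (Proper i, Proper j)"
    by (metis proper.exhaust surj_pair)
  show ?case
    unfolding x
    using word_subst_proper[of w _ "foldr polar_gen v" i j, OF snoc.prems snoc.IH
        foldr_add[of polar_gen, OF polar_gen_linear] foldr_zero[of polar_gen, OF polar_gen_linear]]
    by (simp add: polar_gen_def)
qed simp

lemma word_act_gl_incl:
  fixes w :: "(('p, 'q, 'n) sym \<times> 'd::finite) list"
  assumes "proper_word w"
  shows "Ugl_word_act (gl_incl u) word_eval w = U_act u (word_eval w)"
proof (induction u rule: Ugl.abs_induct)
  case (1 p)
  have "word_act (free_map (map_prod Low Low) p) word_eval w = free_act polar_gen p (word_eval w)"
    by (induction p rule: poly_mapping_add_induct)
      (simp_all add: free_map_add word_act_add free_act_add word_act_single free_act_single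
        foldl_word_subst_proper[OF assms])
  then show ?case
    by (simp add: gl_incl.abs_eq Ugl_word_act.abs_eq U_act.abs_eq)
qed

lemma word_eval_surj:
  "\<exists>w :: (('p, 'q, 'n) sym \<times> 'd) list. proper_word w \<and> word_eval w = Poly_Mapping.single m 1"
proof (induction m rule: poly_mapping_add_induct)
  case zero
  show ?case
    by (rule exI[of _ "[]"]) (simp add: proper_word_def)
next
  case (single v a)
  show ?case
  proof (induction a)
    case 0
    show ?case
      by (rule exI[of _ "[]"]) (simp add: proper_word_def)
  next
    case (Suc a)
    then obtain w :: "(('p, 'q, 'n) sym \<times> 'd) list" where
      w: "proper_word w" "word_eval w = Poly_Mapping.single (Poly_Mapping.single v a) 1"
      by blast
    obtain k \<phi> where v: "v = (k, \<phi>)"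
      by fastforce
    have "word_eval ((Low (Proper k), \<phi>) # w)
        = Poly_Mapping.single (Poly_Mapping.single v (Suc a)) 1"
      by (simp add: w(2)) (simp add: X_def v mult_single flip: single_add)
    moreover have "proper_word ((Low (Proper k), \<phi>) # w)"
      using w(1) by (simp add: proper_word_def)
    ultimately show ?case
      by blast
  qed
next
  case (add m m')
  then obtain w w' :: "(('p, 'q, 'n) sym \<times> 'd) list" where
    "proper_word w" "word_eval w = Poly_Mapping.single m 1"
    "proper_word w'" "word_eval w' = Poly_Mapping.single m' 1"
    by blast
  then show ?case
    by (intro exI[of _ "w @ w'"]) (auto simp: proper_word_def mult_single)
qed

lemma U_act_linear:
  fixes f g :: "('n, 'd::finite) polyM"
  shows "U_act u (f + g) = U_act u f + U_act u g"
    and "U_act u (Const c * f) = Const c * U_act u f"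
  by (induction u rule: Ugl.abs_induct, simp add: U_act.abs_eq
      free_act_add_right[of polar_gen, OF polar_gen_linear]
      free_act_scale[of polar_gen, OF polar_gen_linear])+

text \<open>Takes the place of the trivial intersection of \<open>U(gl(n))\<close> with
  \<open>Irr\<close>: not \<open>u = 0\<close> but the vanishing of its action is obtained, so the
  action does not depend on the element picked by \<open>devirt\<close>.\<close>

lemma U_act_eq_zero:
  fixes f :: "('n, 'd::finite) polyM"
  assumes "(gl_incl u :: ('p, 'q, 'n) sym Ugl) \<in> Irr"
  shows "U_act u f = 0"
proof (induction f rule: poly_mapping_add_induct)
  case zero
  show ?case
    using U_act_linear(2)[of u 0 0] by simp
next
  case (single m c)
  obtain w :: "(('p, 'q, 'n) sym \<times> 'd) list" where
    w: "proper_word w" "word_eval w = Poly_Mapping.single m 1"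
    using word_eval_surj by blast
  have "U_act u (Poly_Mapping.single m 1) = 0"
    using word_act_gl_incl[OF w(1), of u] Irr_word_act[OF assms w(1), of word_eval] by (simp add: w(2))
  then show ?case
    using U_act_linear(2)[of u c "Poly_Mapping.single m 1"] by (simp add: Const_def mult_single)
next
  case (add f g)
  then show ?case
    by (simp add: U_act_linear)
qed

section \<open>Column bitableaux modulo irregular elements\<close>

lemma Irr_zero: "0 \<in> Irr"
  by (simp add: Irr_def left_ideal.zero)

lemma Irr_add: "x \<in> Irr \<Longrightarrow> y \<in> Irr \<Longrightarrow> x + y \<in> Irr"
  unfolding Irr_def by (rule left_ideal.add)

lemma Irr_mult: "x \<in> Irr \<Longrightarrow> r * x \<in> Irr"
  unfolding Irr_def
  by (induction rule: left_ideal.induct)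
    (auto simp: distrib_left mult.assoc[symmetric] intro: left_ideal.intros)

lemma Irr_uminus: "x \<in> Irr \<Longrightarrow> - x \<in> Irr"
  using Irr_mult[of x "- 1"] by simp

lemma Irr_diff: "x \<in> Irr \<Longrightarrow> y \<in> Irr \<Longrightarrow> x - y \<in> Irr"
  using Irr_add[of x "- y"] Irr_uminus by auto

section \<open>Commutation relations and the recursion for lowering and raising products\<close>

abbreviation lowering :: "'n list \<Rightarrow> ('p, 'q, 'n) sym list \<Rightarrow> ('p, 'q, 'n) sym Ugl" where
  "lowering rs \<alpha>s \<equiv> prod_list (map2 (\<lambda>i \<alpha>. Ue (Low (Proper i)) \<alpha>) rs \<alpha>s)"

abbreviation raising :: "('p, 'q, 'n) sym list \<Rightarrow> 'n list \<Rightarrow> ('p, 'q, 'n) sym Ugl" where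
  "raising \<alpha>s cs \<equiv> prod_list (map2 (\<lambda>\<alpha> j. Ue \<alpha> (Low (Proper j))) \<alpha>s cs)"

text \<open>Symbols of \<open>A0\<close> are even and proper ones odd, so both generators are odd;
  both delta terms vanish, as a virtual symbol is never proper.\<close>

lemma Ue_lowering_anticommute:
  assumes "\<alpha> \<in> A0" "\<beta> \<in> A0"
  shows "Ue (Low r) \<alpha> * Ue (Low s) \<beta> = - (Ue (Low s) \<beta> * Ue (Low r) \<alpha>)"
  using assms Ue_superbracket[of "Low r" \<alpha> "Low s" \<beta>]
  by (auto simp: A0_def super_sign_def parity_sym_def parity_proper_def Uscalar_uminus_one
      eq_neg_iff_add_eq_0)

lemma Ue_lowering_proper:
  assumes "\<beta> \<in> A0"
  shows "Ue (Low r) \<beta> * Ue (Low i) (Low j)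
    = Ue (Low i) (Low j) * Ue (Low r) \<beta> - (if r = j then Ue (Low i) \<beta> else 0)"
  using assms Ue_superbracket[of "Low r" \<beta> "Low i" "Low j"]
  by (auto simp: A0_def super_sign_def parity_sym_def parity_proper_def Uscalar_one algebra_simps)

lemma Ue_lowering_raising:
  assumes "\<alpha> \<in> A0"
  shows "Ue (Low i) \<alpha> * Ue \<alpha> (Low j)
    = Ue (Low i) (Low j) - Ue \<alpha> (Low j) * Ue (Low i) \<alpha> + (if i = j then Ue \<alpha> \<alpha> else 0)"
  using assms Ue_superbracket[of "Low i" \<alpha> \<alpha> "Low j"]
  by (auto simp: A0_def super_sign_def parity_sym_def parity_proper_def Uscalar_uminus_one algebra_simps)

text \<open>Pushing \<open>e_{i,\<alpha>}\<close> to the right costs one sign per lowering factor;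
  meeting \<open>e_{\<alpha>,j}\<close> it leaves \<open>e_{i,j}\<close> plus terms ending in some
  \<open>Ue a \<alpha> * y\<close>. Bringing \<open>e_{i,j}\<close> back to the front yields the sum
  over \<open>k\<close>. Both \<open>a = Low (Proper i)\<close> and \<open>a = \<alpha>\<close>
  occur, hence the quantified hypothesis on \<open>y\<close>.\<close>

lemma column_step:
  fixes y :: "('p, 'q, 'n) sym Ugl"
  assumes "length rs = length \<alpha>s" "set \<alpha>s \<subseteq> A0" "\<alpha> \<in> A0"
    and y: "\<And>a. Ue a \<alpha> * y \<in> Irr"
  shows "Ue (Low (Proper i)) \<alpha> * (lowering rs \<alpha>s * (Ue \<alpha> (Low (Proper j)) * y))
    - (- 1) ^ length rs * (Ue (Low (Proper i)) (Low (Proper j)) * (lowering rs \<alpha>s * y)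
        - (\<Sum>k<length rs. if rs ! k = j then lowering (rs[k := i]) \<alpha>s * y else 0)) \<in> Irr"
  using assms(1,2)
proof (induction rs \<alpha>s rule: list_induct2)
  case Nil
  have "Ue (Low (Proper i)) \<alpha> * (Ue \<alpha> (Low (Proper j)) * y) - Ue (Low (Proper i)) (Low (Proper j)) * y
    = (if i = j then Ue \<alpha> \<alpha> * y else 0) - Ue \<alpha> (Low (Proper j)) * (Ue (Low (Proper i)) \<alpha> * y)"
    by (simp add: Ue_lowering_raising[OF assms(3)] left_diff_distrib distrib_right
        flip: mult.assoc)
  also have "\<dots> \<in> Irr"
    by (intro Irr_diff Irr_mult y) (simp add: y Irr_zero)
  finally show ?case
    by simp
next
  case (Cons r rs \<beta> \<alpha>s)
  let ?e = "Ue (Low (Proper i)) (Low (Proper j)) :: ('p, 'q, 'n) sym Ugl"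
  let ?S = "\<Sum>k<length rs. if rs ! k = j then lowering (rs[k := i]) \<alpha>s * y else 0"
  let ?Z = "lowering rs \<alpha>s * (Ue \<alpha> (Low (Proper j)) * y)"
  let ?b = "\<lambda>r. Ue (Low (Proper r)) \<beta>"
  have \<beta>: "\<beta> \<in> A0"
    using Cons.prems by simp
  \<comment> \<open>The summand \<open>k = 0\<close> replaces the head \<open>r\<close> by
    \<open>i\<close>; it matches the correction from commuting \<open>e_{i,j}\<close> past the first
    factor.\<close>
  have "(\<Sum>k<length (r # rs). if (r # rs) ! k = j then lowering ((r # rs)[k := i]) (\<beta> # \<alpha>s) * y else 0)
    = (if r = j then ?b i * (lowering rs \<alpha>s * y) else 0) + ?b r * ?S"
    by (simp add: sum.lessThan_Suc_shift sum_distrib_left mult.assoc if_distrib[of "(*) _"]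
        cong: if_cong del: sum.lessThan_Suc)
  moreover have "Ue (Low (Proper i)) \<alpha> * (?b r * ?Z) = - (?b r * (Ue (Low (Proper i)) \<alpha> * ?Z))"
    using Ue_lowering_anticommute[OF assms(3) \<beta>, of "Proper i" "Proper r"]
    by (simp flip: mult.assoc)
  moreover have "?b r * (?e * (lowering rs \<alpha>s * y))
    = ?e * (?b r * (lowering rs \<alpha>s * y)) - (if r = j then ?b i * (lowering rs \<alpha>s * y) else 0)"
    using Ue_lowering_proper[OF \<beta>, of "Proper r" "Proper i" "Proper j"]
    by (simp add: left_diff_distrib flip: mult.assoc)
  ultimately have "Ue (Low (Proper i)) \<alpha> * (lowering (r # rs) (\<beta> # \<alpha>s) * (Ue \<alpha> (Low (Proper j)) * y))
    - (- 1) ^ length (r # rs) * (?e * (lowering (r # rs) (\<beta> # \<alpha>s) * y)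
        - (\<Sum>k<length (r # rs). if (r # rs) ! k = j then lowering ((r # rs)[k := i]) (\<beta> # \<alpha>s) * y else 0))
    = - (?b r * (Ue (Low (Proper i)) \<alpha> * ?Z
        - (- 1) ^ length rs * (?e * (lowering rs \<alpha>s * y) - ?S)))"
    by (cases "even (length rs)") (simp_all add: mult.assoc right_diff_distrib algebra_simps)
  also have "\<dots> \<in> Irr"
    using Cons by (intro Irr_uminus Irr_mult) simp
  finally show ?case .
qed

text \<open>The leftmost factor removes \<open>\<alpha>\<close>, which no factor to its right has
  created.\<close>

lemma raising_irregular:
  fixes a :: "('p, 'q, 'n) sym"
  assumes "set \<alpha>s \<subseteq> A0" "\<alpha> \<in> A0" "\<alpha> \<notin> set \<alpha>s"
  shows "Ue a \<alpha> * raising \<alpha>s cs \<in> Irr"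
proof -
  let ?v = "map2 (\<lambda>\<alpha> j. (\<alpha>, Low (Proper j) :: ('p, 'q, 'n) sym)) \<alpha>s cs"
  let ?w = "(a, \<alpha>) # ?v"
  have fst: "count_list (map fst (rev ?v)) \<alpha> = 0"
    using assms(3) by (auto simp: count_list_0_iff dest: set_zip_leftD)
  have "irregular_word ?w"
    unfolding irregular_word_def
    \<comment> \<open>Numbering runs from right to left, so the factor \<open>(a, \<alpha>)\<close>
      is counted only when the whole word is taken.\<close>
    by (rule bexI[of _ "length ?w"], rule bexI[of _ \<alpha>]) (use assms(2) fst in auto)
  moreover have "Ue a \<alpha> * raising \<alpha>s cs = prod_list (map (\<lambda>(a, b). Ue a b) ?w)"
    by (simp add: case_prod_unfold comp_def)
  ultimately have "1 * (Ue a \<alpha> * raising \<alpha>s cs) \<in> Irr"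
    unfolding Irr_def by (intro left_ideal.gen) blast
  then show ?thesis
    by simp
qed

section \<open>The normally ordered polarization operators\<close>

definition normal_ordered :: "'n list \<Rightarrow> 'n list \<Rightarrow> ('n, 'd::finite) polyM \<Rightarrow> ('n, 'd) polyM" where
  "normal_ordered rs cs f = (\<Sum>\<phi>s \<in> {\<phi>s :: 'd list. length \<phi>s = length cs}.
     prod_list (map2 X rs \<phi>s) * foldr (\<lambda>(j, \<phi>). pderivM j \<phi>) (zip cs \<phi>s) f)"

lemma normal_ordered_Nil: "normal_ordered [] [] f = f"
  by (simp add: normal_ordered_def)

lemma polarization_sum:
  fixes g :: "'k \<Rightarrow> ('n, 'd::finite) polyM"
  shows "polarization i j (\<Sum>k\<in>A. g k) = (\<Sum>k\<in>A. polarization i j (g k))"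
proof -
  have "polarization i j (f + g) = polarization i j f + polarization i j g"
    for f g :: "('n, 'd) polyM"
    using polarization(1)[of i j] unfolding derivation_def by blast
  then show ?thesis
    by (induction A rule: infinite_finite_induct) (simp_all add: derivation_zero[OF polarization(1)])
qed

lemma polarization_prod_list:
  fixes \<phi>s :: "'d::finite list"
  assumes "length rs = length \<phi>s"
  shows "polarization i j (prod_list (map2 X rs \<phi>s))
    = (\<Sum>k<length rs. if rs ! k = j then prod_list (map2 X (rs[k := i]) \<phi>s) else 0)"
  using assms
proof (induction rs \<phi>s rule: list_induct2)
  case Nil
  show ?case
    by (simp add: polarization_one)
next
  case (Cons r rs \<phi> \<phi>s)
  then show ?case
    by (simp add: polarization_mult polarization(2) sum.lessThan_Suc_shift sum_distrib_left
        if_distrib[of "(*) _"] cong: if_cong del: sum.lessThan_Suc)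
qed

text \<open>Leibniz rule for \<open>polarization i j\<close> on a product of variables times a
  derivative: hitting the derivative gives the longer normally ordered operator, hitting the
  variable \<open>X (rs ! k)\<close> turns it into \<open>X i\<close>.\<close>

lemma normal_ordered_Cons:
  assumes "length rs = length cs"
  shows "normal_ordered (i # rs) (j # cs) f = polarization i j (normal_ordered rs cs f)
    - (\<Sum>k<length rs. if rs ! k = j then normal_ordered (rs[k := i]) cs f else 0)"
proof -
  let ?D = "\<lambda>\<phi>s. foldr (\<lambda>(j, \<phi>). pderivM j \<phi>) (zip cs \<phi>s) f"
  let ?L = "{\<phi>s. length \<phi>s = length cs}"
  have "normal_ordered (i # rs) (j # cs) f
      = (\<Sum>(\<phi>, \<phi>s)\<in>UNIV \<times> ?L. X i \<phi> * prod_list (map2 X rs \<phi>s) * pderivM j \<phi> (?D \<phi>s))"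
    unfolding normal_ordered_def
    by (rule sum.reindex_bij_witness[of _ "\<lambda>(\<phi>, \<phi>s). \<phi> # \<phi>s" "\<lambda>\<phi>s. (hd \<phi>s, tl \<phi>s)"])
      (auto simp: length_Suc_conv)
  \<comment> \<open>Summing over the new column index \<open>\<phi>\<close> assembles the
    polarization from \<open>X i \<phi>\<close> and \<open>pderivM j \<phi>\<close>.\<close>
  also have "\<dots> = (\<Sum>\<phi>s\<in>?L. prod_list (map2 X rs \<phi>s) * polarization i j (?D \<phi>s))"
    by (simp add: sum.cartesian_product[symmetric] sum.swap[of _ ?L] polarization_eq
        sum_distrib_left mult_ac)
  also have "\<dots> = (\<Sum>\<phi>s\<in>?L. polarization i j (prod_list (map2 X rs \<phi>s) * ?D \<phi>s)
      - (\<Sum>k<length rs. if rs ! k = j then prod_list (map2 X (rs[k := i]) \<phi>s) * ?D \<phi>s else 0))"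
    by (rule sum.cong)
      (simp_all add: polarization_mult polarization_prod_list assms sum_distrib_right
        if_distrib[of "\<lambda>x. x * _"] cong: if_cong)
  also have "\<dots> = polarization i j (normal_ordered rs cs f)
    - (\<Sum>k<length rs. if rs ! k = j then normal_ordered (rs[k := i]) cs f else 0)"
    unfolding normal_ordered_def sum_subtractf polarization_sum
    by (subst sum.swap) (auto intro!: sum.cong)
  finally show ?thesis .
qed

section \<open>Compatibility of the action and of the inclusion with ring operations\<close>

lemma U_act_simps:
  fixes f :: "('n, 'd::finite) polyM"
  shows "U_act 0 f = 0" and "U_act 1 f = f" and "U_act (- u) f = - U_act u f"
    and "U_act (u - v) f = U_act u f - U_act v f"
    and "U_act (\<Sum>k\<in>A. g k) f = (\<Sum>k\<in>A. U_act (g k) f)"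
proof -
  show zero: "U_act 0 f = 0"
    using U_act_hom(2)[of 0 f] by (simp add: Uscalar.abs_eq zero_Ugl.abs_eq)
  show "U_act 1 f = f"
    using U_act_hom(2)[of 1 f] by (simp add: Uscalar_one)
  show uminus: "U_act (- u) f = - U_act u f" for u
    using U_act_hom(3)[of u "- u" f] zero by (simp add: eq_neg_iff_add_eq_0 add.commute)
  show "U_act (u - v) f = U_act u f - U_act v f"
    using U_act_hom(3)[of u "- v" f] uminus by simp
  show "U_act (\<Sum>k\<in>A. g k) f = (\<Sum>k\<in>A. U_act (g k) f)"
    by (induction A rule: infinite_finite_induct) (simp_all add: zero U_act_hom)
qed

lemma gl_incl_zero: "gl_incl 0 = 0"
  by (simp add: gl_incl.abs_eq zero_Ugl.abs_eq)

lemma gl_incl_one: "gl_incl 1 = 1"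
  using gl_incl_hom(2)[of 1] by (simp add: Uscalar_one)

lemma gl_incl_uminus: "gl_incl (- u) = - gl_incl u"
  using gl_incl_hom(3)[of u "- u"] by (simp add: gl_incl_zero eq_neg_iff_add_eq_0 add.commute)

lemma gl_incl_diff: "gl_incl (u - v) = gl_incl u - gl_incl v"
  using gl_incl_hom(3)[of u "- v"] by (simp add: gl_incl_uminus)

lemma gl_incl_sum: "gl_incl (\<Sum>k\<in>A. g k) = (\<Sum>k\<in>A. gl_incl (g k))"
  by (induction A rule: infinite_finite_induct) (simp_all add: gl_incl_zero gl_incl_hom)

lemmas gl_incl_simps = gl_incl_zero gl_incl_one gl_incl_uminus gl_incl_diff gl_incl_sum

text \<open>A representative modulo \<open>Irr\<close> is built by the recursion of
  \<open>column_step\<close>, and its action is followed by \<open>normal_ordered_Cons\<close>. The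
  two recursions differ by a sign at each step, and these signs multiply to the binomial
  one.\<close>

lemma column_product:
  fixes \<alpha>s :: "('p, 'q, 'n) sym list"
  assumes "length \<alpha>s = length cs" "length rs = length cs" "distinct \<alpha>s" "set \<alpha>s \<subseteq> A0"
  shows "\<exists>u. lowering rs \<alpha>s * raising \<alpha>s cs - gl_incl u \<in> Irr
    \<and> (\<forall>f :: ('n, 'd::finite) polyM.
         U_act u f = (- 1) ^ (length cs choose 2) * normal_ordered rs cs f)"
  using assms
proof (induction \<alpha>s cs arbitrary: rs rule: list_induct2)
  case Nil
  show ?case
    by (rule exI[of _ 1])
      (use Nil in \<open>simp add: gl_incl_simps U_act_simps normal_ordered_Nil Irr_zero numeral_2_eq_2\<close>)
next
  case (Cons \<alpha> \<alpha>s j cs)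
  obtain i rs' where rs: "rs = i # rs'"
    using Cons.prems by (cases rs) auto
  have len: "length rs' = length cs"
    using Cons.prems by (simp add: rs)
  \<comment> \<open>The recursion calls the shorter case at several row lists
    \<open>rs'[k := i]\<close>, so representatives are chosen for all of them at once.\<close>
  have "\<forall>rs. \<exists>u. length rs = length cs \<longrightarrow> lowering rs \<alpha>s * raising \<alpha>s cs - gl_incl u \<in> Irr
    \<and> (\<forall>f :: ('n, 'd) polyM. U_act u f = (- 1) ^ (length cs choose 2) * normal_ordered rs cs f)"
    using Cons by auto
  then obtain U where
    U: "\<And>rs. length rs = length cs \<Longrightarrow> lowering rs \<alpha>s * raising \<alpha>s cs - gl_incl (U rs) \<in> Irr"
      "\<And>rs f. length rs = length cs \<Longrightarrow>
        U_act (U rs) (f :: ('n, 'd) polyM) = (- 1) ^ (length cs choose 2) * normal_ordered rs cs f"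
    by metis
  let ?e = "Ue (Proper i) (Proper j) :: 'n Ugln"
  define u where "u = (- 1) ^ length cs *
    (?e * U rs' - (\<Sum>k<length rs'. if rs' ! k = j then U (rs'[k := i]) else 0))"
  let ?x = "lowering rs (\<alpha> # \<alpha>s) * raising (\<alpha> # \<alpha>s) (j # cs)"
  let ?y = "\<lambda>rs. lowering rs \<alpha>s * raising \<alpha>s cs"
  let ?S = "\<lambda>g. \<Sum>k<length rs'. if rs' ! k = j then g (rs'[k := i]) else (0 :: ('p, 'q, 'n) sym Ugl)"
  have "?x - (- 1) ^ length cs * (gl_incl ?e * ?y rs' - ?S ?y) \<in> Irr"
    using column_step[of rs' \<alpha>s \<alpha> "raising \<alpha>s cs" i j] raising_irregular[of \<alpha>s \<alpha> _ cs]
      Cons.prems Cons.hyps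
    by (simp add: rs len gl_incl_hom mult.assoc)
  \<comment> \<open>The error made when the shorter products are replaced by their
    representatives.\<close>
  moreover have "gl_incl ?e * (?y rs' - gl_incl (U rs')) - ?S (\<lambda>rs. ?y rs - gl_incl (U rs)) \<in> Irr"
  proof (rule Irr_diff[OF Irr_mult[OF U(1)[OF len]]])
    have "(\<Sum>k\<in>A. if rs' ! k = j then ?y (rs'[k := i]) - gl_incl (U (rs'[k := i])) else 0) \<in> Irr" for A
      by (induction A rule: infinite_finite_induct) (auto intro!: Irr_zero Irr_add U simp: len)
    then show "?S (\<lambda>rs. ?y rs - gl_incl (U rs)) \<in> Irr" .
  qed
  ultimately have mem: "?x - (- 1) ^ length cs * (gl_incl ?e * ?y rs' - ?S ?y)
    + (- 1) ^ length cs * (gl_incl ?e * (?y rs' - gl_incl (U rs')) - ?S (\<lambda>rs. ?y rs - gl_incl (U rs))) \<in> Irr"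
    by (rule Irr_add[OF _ Irr_mult])
  have S_diff: "?S (\<lambda>rs. ?y rs - gl_incl (U rs)) = ?S ?y - ?S (\<lambda>rs. gl_incl (U rs))"
    unfolding sum_subtractf[symmetric] by (rule sum.cong) auto
  have gl_u: "gl_incl u
      = (- 1) ^ length cs * (gl_incl ?e * gl_incl (U rs') - ?S (\<lambda>rs. gl_incl (U rs)))"
    unfolding u_def
    by (cases "even (length cs)")
      (simp_all add: gl_incl_hom(4) gl_incl_simps if_distrib[of gl_incl] cong: if_cong)
  from mem have "?x - gl_incl u \<in> Irr"
    unfolding S_diff gl_u by (simp add: algebra_simps)
  moreover have "U_act u f = (- 1) ^ (length (j # cs) choose 2) * normal_ordered rs (j # cs) f"
    for f :: "('n, 'd) polyM"
  proof -
    let ?c = "length cs choose 2"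
    have scale: "polarization i j ((- 1) ^ k * g) = (- 1) ^ k * polarization i j (g :: ('n, 'd) polyM)" for k g
      using polarization(1)[of i j] unfolding derivation_def by (metis Const_uminus_one_power)
    have "U_act u f = (- 1) ^ length cs * (polarization i j ((- 1) ^ ?c * normal_ordered rs' cs f)
      - (\<Sum>k<length rs'. if rs' ! k = j then (- 1) ^ ?c * normal_ordered (rs'[k := i]) cs f else 0))"
      unfolding u_def
      by (cases "even (length cs)")
        (simp_all add: U_act_hom(1,4) U_act_simps U len if_distrib[of "\<lambda>u. U_act u f"] cong: if_cong)
    also have "\<dots> = (- 1) ^ length cs * (- 1) ^ ?c * normal_ordered rs (j # cs) f"
      by (simp add: rs scale normal_ordered_Cons[OF len] right_diff_distrib sum_distrib_left mult.assoc
          if_distrib[of "(*) _"] cong: if_cong)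
    \<comment> \<open>Pascal's rule: \<open>n + (n choose 2) = (Suc n choose 2)\<close>.\<close>
    also have "(- 1) ^ length cs * (- 1) ^ ?c = ((- 1) ^ (length (j # cs) choose 2) :: ('n, 'd) polyM)"
      by (simp add: numeral_2_eq_2 flip: power_add)
    finally show ?thesis .
  qed
  ultimately show ?case
    by blast
qed

theorem proposition4p10:
  fixes h :: nat and rs cs :: "'n::finite list"
    and \<alpha>s :: "('p::finite, 'q::finite, 'n) sym list"
    and f :: "('n, 'd::finite) polyM"
  assumes "h \<ge> 1"
    and "length rs = h" and "length cs = h"
    and "length \<alpha>s = h" and "distinct \<alpha>s" and "set \<alpha>s \<subseteq> A0"
  shows "U_act (column_capelli \<alpha>s rs cs) f =
    (- 1) ^ (h choose 2) * (\<Sum>\<phi>s \<in> {\<phi>s :: 'd list. length \<phi>s = h}.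
       prod_list (map2 X rs \<phi>s) * foldr (\<lambda>(j, \<phi>). pderivM j \<phi>) (zip cs \<phi>s) f)"
proof -
  let ?x = "lowering rs \<alpha>s * raising \<alpha>s cs"
  obtain u where u: "?x - gl_incl u \<in> Irr"
    and act: "\<And>f :: ('n, 'd) polyM. U_act u f = (- 1) ^ (length cs choose 2) * normal_ordered rs cs f"
    using column_product[of \<alpha>s cs rs, where ?'d = 'd] assms by auto
  \<comment> \<open>Membership in \<open>Virt\<close> is what gives the choice in
    \<open>devirt\<close> its meaning.\<close>
  have "?x \<in> Virt"
    using u unfolding Virt_def by force
  then have "?x - gl_incl (column_capelli \<alpha>s rs cs) \<in> Irr"
    unfolding column_capelli_def by (rule devirt)
  \<comment> \<open>Both \<open>u\<close> and the bitableau represent \<open>?x\<close> modulo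
    \<open>Irr\<close>, so their difference acts as zero.\<close>
  from Irr_diff[OF u this]
  have "(gl_incl (column_capelli \<alpha>s rs cs - u) :: ('p, 'q, 'n) sym Ugl) \<in> Irr"
    by (simp add: gl_incl_simps)
  then have "U_act (column_capelli \<alpha>s rs cs - u) f = 0"
    by (rule U_act_eq_zero)
  then show ?thesis
    using act[of f] assms(3) by (simp add: U_act_simps normal_ordered_def)
qed

end
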